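(* Let $G$ be a 3-connected graph, $G'$ a graph, and $f$ a circuit injection from $G$ onto $G'$. Let $w$ be a vertex of $G'$ and $S(w)$ its star. Then $f^{-1}(S(w))$ is either a star subgraph $S(v)$ of $G$ (for some vertex $v$ of $G$) or an independent (pairwise nonadjacent) set of edges of $G$.
   Context: Graphs are undirected, finite or infinite, without loops or multiple edges; a circuit is a (finite) cycle, regarded as its set of edges. For a vertex $v$, the star subgraph $S(v)$ is the set of all edges incident to $v$. A circuit injection from $G$ onto $G'$ is a one-to-one map $f$ from the edge set of $G$ onto the edge set of $G'$ such that $f(C)$ is a circuit of $G'$ whenever $C$ is a circuit of $G$; "onto $G'$" includes the requirement that $G'$ has no isolated vertices. *)

theory Defs
  imports Main
begin

text \<open>
  A simple undirected graph, finite or infinite, is given by its vertex set \<open>V\<close> and its edge set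
  \<open>E\<close>, where an edge is the two-element set of its end vertices.
\<close>

locale simple_graph =
  fixes V :: "'a set" and E :: "'a set set"
  assumes edges_wf: "E \<subseteq> {{u, v} | u v. u \<in> V \<and> v \<in> V \<and> u \<noteq> v}"

definition no_isolated_vertices :: "'a set \<Rightarrow> 'a set set \<Rightarrow> bool" where
  "no_isolated_vertices V E \<longleftrightarrow> (\<forall>v\<in>V. \<exists>e\<in>E. v \<in> e)"

definition star :: "'a set set \<Rightarrow> 'a \<Rightarrow> 'a set set" where
  "star E v = {e \<in> E. v \<in> e}"

definition pairwise_nonadjacent :: "'a set set \<Rightarrow> bool" where
  "pairwise_nonadjacent A \<longleftrightarrow> (\<forall>e\<in>A. \<forall>e'\<in>A. e \<noteq> e' \<longrightarrow> e \<inter> e' = {})"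

definition cycle_edges :: "'a list \<Rightarrow> 'a set set" where
  "cycle_edges vs = {{vs ! i, vs ! (Suc i mod length vs)} | i. i < length vs}"

definition circuit :: "'a set set \<Rightarrow> 'a set set \<Rightarrow> bool" where
  "circuit E C \<longleftrightarrow>
     C \<subseteq> E \<and> (\<exists>vs. distinct vs \<and> length vs \<ge> 3 \<and> C = cycle_edges vs)"

definition connected_graph :: "'a set \<Rightarrow> 'a set set \<Rightarrow> bool" where
  "connected_graph V E \<longleftrightarrow>
     V \<noteq> {} \<and> (\<forall>u\<in>V. \<forall>v\<in>V. (u, v) \<in> {(x, y). {x, y} \<in> E}\<^sup>*)"

text \<open>
  More than \<open>k\<close> vertices, and deleting fewer than \<open>k\<close> of them, together with all
  edges incident to them, never disconnects the graph. Finiteness is explicit because \<open>card\<close> is 0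
  on infinite sets.
\<close>

definition k_connected :: "nat \<Rightarrow> 'a set \<Rightarrow> 'a set set \<Rightarrow> bool" where
  "k_connected k V E \<longleftrightarrow>
     (infinite V \<or> card V > k) \<and>
     (\<forall>X. X \<subseteq> V \<and> finite X \<and> card X < k \<longrightarrow>
          connected_graph (V - X) {e \<in> E. e \<inter> X = {}})"

definition circuit_injection_onto ::
    "'a set set \<Rightarrow> 'b set \<Rightarrow> 'b set set \<Rightarrow> ('a set \<Rightarrow> 'b set) \<Rightarrow> bool" where
  "circuit_injection_onto E V' E' f \<longleftrightarrow>
     no_isolated_vertices V' E' \<and> bij_betw f E E' \<and>
     (\<forall>C. circuit E C \<longrightarrow> circuit E' (f ` C))"

end

theory Submission
  imports Defs
begin

text \<open>
  Let \<open>A\<close> be the preimage of the star of \<open>w\<close>. A circuit of \<open>G'\<close> has no or exactly two edges at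
  \<open>w\<close>, so every circuit of \<open>G\<close> has no or exactly two edges in \<open>A\<close>. Suppose that \<open>A\<close> contains two
  adjacent edges \<open>va\<close> and \<open>vb\<close>. Since \<open>G - v\<close> is 2-connected, each of its edges lies on a path from
  \<open>a\<close> to \<open>b\<close> in \<open>G - v\<close>, which closes to a circuit through \<open>va\<close> and \<open>vb\<close>; hence \<open>A\<close> has no edge
  outside the star of \<open>v\<close>. If \<open>vc\<close> were an edge not in \<open>A\<close>, then a path from \<open>a\<close> to \<open>c\<close> in
  \<open>G - v\<close> would close to a circuit whose only edge in \<open>A\<close> is \<open>va\<close>.
\<close>

section \<open>Edges of walks and cycles given by vertex lists\<close>

fun walk_edges :: "'a list \<Rightarrow> 'a set set" where
  "walk_edges (x # y # xs) = insert {x, y} (walk_edges (y # xs))"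
| "walk_edges _ = {}"

text \<open>A one-vertex list is a path for any \<open>D\<close>, so \<open>a = b\<close> is
  possible; vertices are constrained only through the edges.\<close>

definition is_path :: "'a set set \<Rightarrow> 'a \<Rightarrow> 'a \<Rightarrow> 'a list \<Rightarrow> bool" where
  "is_path D a b p \<longleftrightarrow>
     p \<noteq> [] \<and> distinct p \<and> walk_edges p \<subseteq> D \<and> hd p = a \<and> last p = b"

lemma walk_edges_Cons:
  "xs \<noteq> [] \<Longrightarrow> walk_edges (x # xs) = insert {x, hd xs} (walk_edges xs)"
  by (cases xs) auto

lemma walk_edges_append:
  "xs \<noteq> [] \<Longrightarrow> ys \<noteq> [] \<Longrightarrow>
     walk_edges (xs @ ys) = insert {last xs, hd ys} (walk_edges xs \<union> walk_edges ys)"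
  by (induction xs rule: walk_edges.induct) (auto simp: walk_edges_Cons)

lemma walk_edges_rev [simp]: "walk_edges (rev xs) = walk_edges xs"
proof (induction xs)
  case (Cons x xs)
  then show ?case
    by (cases "xs = []")
       (simp_all add: walk_edges_append walk_edges_Cons last_rev insert_commute)
qed simp

lemma walk_edges_subset: "e \<in> walk_edges xs \<Longrightarrow> e \<subseteq> set xs"
  by (induction xs rule: walk_edges.induct) auto

text \<open>Turns avoidance by edges into avoidance by vertices: a vertex on no edge of a path and
  different from its start is off the path. The head is exempt because a one-vertex walk has no
  edges.\<close>

lemma set_subset_walk_edges: "set xs \<subseteq> insert (hd xs) (\<Union> (walk_edges xs))"
  by (induction xs rule: walk_edges.induct) auto

lemma walk_edges_conv_nth:
  "walk_edges xs = {{xs ! i, xs ! Suc i} | i. Suc i < length xs}"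
proof (induction xs rule: walk_edges.induct)
  case (1 x y xs)
  have "{{(x # y # xs) ! i, (x # y # xs) ! Suc i} | i. Suc i < length (x # y # xs)} =
      insert {x, y} {{(y # xs) ! i, (y # xs) ! Suc i} | i. Suc i < length (y # xs)}"
    (is "?L = insert _ ?R")
  proof (intro equalityI subsetI)
    fix e assume "e \<in> ?L"
    then obtain i where "e = {(x # y # xs) ! i, (x # y # xs) ! Suc i}" "Suc i < length (x # y # xs)"
      by blast
    then show "e \<in> insert {x, y} ?R" by (cases i) auto
  next
    fix e assume "e \<in> insert {x, y} ?R"
    then consider "e = {x, y}" | i where "e = {(y # xs) ! i, (y # xs) ! Suc i}" "Suc i < length (y # xs)"
      by blast
    then show "e \<in> ?L"
    proof cases
      case 1
      then show ?thesis by (intro CollectI exI[of _ 0]) simp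
    next
      case (2 i)
      then show ?thesis by (intro CollectI exI[of _ "Suc i"]) simp
    qed
  qed
  then show ?case using 1 by simp
qed auto

text \<open>The index wraps around only at the last position, which contributes the closing edge;
  all other positions give the edges of the walk.\<close>

lemma cycle_edges_conv_walk_edges:
  assumes "xs \<noteq> []"
  shows "cycle_edges xs = insert {last xs, hd xs} (walk_edges xs)"
proof -
  have "i < length xs \<longleftrightarrow> Suc i < length xs \<or> i = length xs - 1" for i
    using assms by (cases xs) auto
  then have "cycle_edges xs =
      insert {xs ! (length xs - 1), xs ! (Suc (length xs - 1) mod length xs)}
        {{xs ! i, xs ! (Suc i mod length xs)} | i. Suc i < length xs}"
    unfolding cycle_edges_def by blast
  also have "{{xs ! i, xs ! (Suc i mod length xs)} | i. Suc i < length xs} = walk_edges xs"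
    unfolding walk_edges_conv_nth by (intro Collect_cong ex_cong1) (auto simp: mod_less)
  finally show ?thesis
    using assms by (simp add: last_conv_nth hd_conv_nth)
qed

lemma cycle_edges_Cons:
  "p \<noteq> [] \<Longrightarrow> cycle_edges (x # p) = insert {x, hd p} (insert {x, last p} (walk_edges p))"
  by (auto simp: cycle_edges_conv_walk_edges walk_edges_Cons insert_commute)

text \<open>Rotation only swaps the closing edge with the edge joining the two pieces.\<close>

lemma cycle_edges_append_commute: "cycle_edges (xs @ ys) = cycle_edges (ys @ xs)"
  by (cases "xs = [] \<or> ys = []")
     (auto simp: cycle_edges_conv_walk_edges walk_edges_append)

text \<open>Once the cycle is rotated to start at \<open>w\<close>, its edges at \<open>w\<close>
  are those to the first and the last vertex of the rest, and these two vertices differ.\<close>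

lemma circuit_inter_star:
  assumes "circuit E C" "e \<in> C" "w \<in> e"
  obtains e' where "e' \<noteq> e" "C \<inter> star E w = {e, e'}"
proof -
  obtain vs where vs: "C \<subseteq> E" "distinct vs" "length vs \<ge> 3" "C = cycle_edges vs"
    using assms(1) unfolding circuit_def by blast
  have "vs \<noteq> []" using vs(3) by auto
  have "w \<in> set vs"
    using assms(2,3) vs(4) \<open>vs \<noteq> []\<close>
    by (auto simp: cycle_edges_conv_walk_edges dest: walk_edges_subset)
  then obtain xs ys where split: "vs = xs @ w # ys"
    by (meson split_list)
  define p where "p = ys @ xs"
  have p: "distinct p" "w \<notin> set p" "length p \<ge> 2"
    using vs(2,3) unfolding split p_def by auto
  have "p \<noteq> []" using p(3) by auto
  have "hd p \<noteq> last p"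
    using p(1,3) by (cases p) auto
  have C: "C = insert {w, hd p} (insert {w, last p} (walk_edges p))"
    using cycle_edges_append_commute[of xs "w # ys"] cycle_edges_Cons[OF \<open>p \<noteq> []\<close>, of w]
    by (simp add: vs(4) split p_def)
  have "w \<notin> g" if "g \<in> walk_edges p" for g
    using that p(2) walk_edges_subset by fast
  then have "C \<inter> star E w = {{w, hd p}, {w, last p}}"
    using vs(1) unfolding C star_def by blast
  moreover have "{w, hd p} \<noteq> {w, last p}"
    using \<open>hd p \<noteq> last p\<close> by (auto simp: doubleton_eq_iff)
  moreover have "e \<in> C \<inter> star E w"
    using assms vs(1) by (auto simp: star_def)
  \<comment> \<open>The given \<open>e\<close> may be either of the two edges, so each is offered as
    the other one.\<close>
  ultimately show ?thesis
    using that[of "{w, hd p}"] that[of "{w, last p}"] by (auto simp: insert_commute)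
qed

section \<open>Paths through a prescribed edge\<close>

text \<open>A walk into \<open>S\<close> is made simple and stopped at its first vertex in
  \<open>S\<close>. With \<open>S\<close> a singleton this gives ordinary paths between two
  vertices.\<close>

lemma path_to_set:
  assumes "(z, t) \<in> {(x, y). {x, y} \<in> D}\<^sup>*" "t \<in> S"
  obtains s q where "s \<in> S" "is_path D z s q" "set (butlast q) \<inter> S = {}"
proof -
  have "\<exists>q. is_path D z (last q) q \<and> last q \<in> S \<and> set (butlast q) \<inter> S = {}"
    using assms(1)
  proof (induction rule: converse_rtrancl_induct)
    case base
    then show ?case using assms(2) by (intro exI[of _ "[t]"]) (auto simp: is_path_def)
  next
    case (step x y)
    then obtain q where q: "is_path D y (last q) q" "last q \<in> S" "set (butlast q) \<inter> S = {}"
      by blast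
    consider "x \<in> S" | "x \<notin> S" "x \<notin> set q" | "x \<notin> S" "x \<in> set q" by blast
    then show ?case
    proof cases
      case 1
      then show ?thesis by (intro exI[of _ "[x]"]) (auto simp: is_path_def)
    next
      case 2
      then show ?thesis
        using q step(1) by (intro exI[of _ "x # q"]) (auto simp: is_path_def walk_edges_Cons)
    next
      \<comment> \<open>Prepending \<open>x\<close> would close a loop, so the path is instead
        started at the occurrence of \<open>x\<close> in \<open>q\<close>.\<close>
      case 3
      then obtain q1 q2 where split: "q = q1 @ x # q2"
        by (meson split_list)
      have "walk_edges (x # q2) \<subseteq> walk_edges q"
        unfolding split by (cases "q1 = []") (auto simp: walk_edges_append)
      then show ?thesis
        using q unfolding split
        by (intro exI[of _ "x # q2"]) (auto simp: is_path_def butlast_append split: if_splits)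
    qed
  qed
  then show ?thesis using that by blast
qed

lemma is_path_rev: "is_path D a b p \<Longrightarrow> is_path D b a (rev p)"
  by (auto simp: is_path_def hd_rev last_rev)

text \<open>The segment \<open>p2\<close> from \<open>y\<close> to \<open>t\<close> gives way to the
  edge \<open>{y, z}\<close> followed by \<open>q\<close>. No vertex repeats, since \<open>q\<close>
  meets the old path only in its last vertex \<open>t\<close>.\<close>

lemma is_path_splice:
  assumes p: "is_path D a b (p1 @ y # p2 @ t # p3)"
    and q: "is_path D z t q" "set (butlast q) \<inter> set (p1 @ y # p2 @ t # p3) = {}"
    and "{y, z} \<in> D"
  shows "is_path D a b (p1 @ y # q @ p3)" "{y, z} \<in> walk_edges (p1 @ y # q @ p3)"
proof -
  obtain q' where q': "q = q' @ [t]"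
    using q(1) unfolding is_path_def by (metis append_butlast_last_id)
  have hd: "hd (q' @ t # p3) = z"
    using q(1) unfolding q' is_path_def by (cases q') auto
  have q_edges: "walk_edges (q' @ [t]) \<subseteq> D"
    using q(1) unfolding q' is_path_def by auto
  have p_edges: "walk_edges (p1 @ [y]) \<subseteq> D" "walk_edges (t # p3) \<subseteq> D"
  proof -
    show "walk_edges (p1 @ [y]) \<subseteq> D"
      using p walk_edges_append[of "p1 @ [y]" "p2 @ t # p3"] unfolding is_path_def by simp
    show "walk_edges (t # p3) \<subseteq> D"
      using p walk_edges_append[of "p1 @ y # p2" "t # p3"] unfolding is_path_def by simp
  qed
  have "walk_edges (q' @ t # p3) \<subseteq> walk_edges (q' @ [t]) \<union> walk_edges (t # p3)"
    by (cases "q' = []") (auto simp: walk_edges_append)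
  moreover have edges: "walk_edges ((p1 @ [y]) @ q' @ t # p3) =
      insert {y, z} (walk_edges (p1 @ [y]) \<union> walk_edges (q' @ t # p3))"
    by (subst walk_edges_append) (auto simp: hd)
  ultimately have "walk_edges (p1 @ y # q @ p3) \<subseteq> D"
    using q_edges p_edges assms(4) unfolding q' by auto
  moreover have "distinct (p1 @ y # q @ p3)"
    using p q unfolding q' is_path_def by auto
  moreover have "hd (p1 @ y # q @ p3) = a" "last (p1 @ y # q @ p3) = b"
    using p unfolding q' is_path_def by (cases p1; cases p3; auto)+
  ultimately show "is_path D a b (p1 @ y # q @ p3)"
    unfolding is_path_def by auto
  show "{y, z} \<in> walk_edges (p1 @ y # q @ p3)"
    using edges unfolding q' by auto
qed

text \<open>
  The other endpoint of the edge is linked back to the path by a path avoiding \<open>y\<close>, and the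
  resulting detour replaces a segment of the path ending in \<open>y\<close>.
\<close>

lemma path_reroute_edge:
  assumes "simple_graph W D"
    and conn: "connected_graph (W - {y}) {e \<in> D. y \<notin> e}"
    and ab: "a \<in> W" "b \<in> W" "a \<noteq> b"
    and p: "is_path D a b p" "y \<in> set p"
    and yz: "{y, z} \<in> D"
  obtains p' where "is_path D a b p'" "{y, z} \<in> walk_edges p'"
proof -
  let ?D = "{e \<in> D. y \<notin> e}"
  have z: "z \<in> W" "z \<noteq> y"
    using simple_graph.edges_wf[OF assms(1)] yz by (auto simp: doubleton_eq_iff)
  \<comment> \<open>As \<open>a\<close> and \<open>b\<close> differ, one of them is not
    \<open>y\<close>; it serves as a target on the path that survives the deletion of
    \<open>y\<close>.\<close>
  obtain c where c: "c \<in> W" "c \<in> set p - {y}"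
  proof (cases "a = y")
    case True
    moreover have "b \<in> set p" using p(1) unfolding is_path_def by (metis last_in_set)
    ultimately show ?thesis using ab that[of b] by blast
  next
    case False
    moreover have "a \<in> set p" using p(1) unfolding is_path_def by (metis hd_in_set)
    ultimately show ?thesis using ab that[of a] by blast
  qed
  have "(z, c) \<in> {(u, v). {u, v} \<in> ?D}\<^sup>*"
    using conn z c unfolding connected_graph_def by blast
  from path_to_set[OF this c(2)] obtain t q where t: "t \<in> set p - {y}"
    and q: "is_path ?D z t q" "set (butlast q) \<inter> (set p - {y}) = {}"
    by metis
  \<comment> \<open>The edges of \<open>q\<close> avoid \<open>y\<close> and its start
    \<open>z\<close> is not \<open>y\<close>, so \<open>q\<close> meets the path only in
    \<open>t\<close>. If \<open>z\<close> already lies on the path, then \<open>q\<close> is just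
    \<open>[z]\<close>.\<close>
  have "y \<notin> set q"
    using set_subset_walk_edges[of q] q(1) z(2) unfolding is_path_def by auto
  then have q_disj: "set (butlast q) \<inter> set p = {}"
    using q(2) by (auto dest: in_set_butlastD)
  have qD: "is_path D z t q"
    using q(1) unfolding is_path_def by auto
  obtain p1 r where split: "p = p1 @ y # r"
    using p(2) by (meson split_list)
  consider "t \<in> set r" | "t \<in> set p1" using t split by auto
  then show ?thesis
  proof cases
    case 1
    then obtain p2 p3 where "r = p2 @ t # p3" by (meson split_list)
    then have "p = p1 @ y # p2 @ t # p3" using split by simp
    then show ?thesis using is_path_splice[of D a b p1 y p2 t p3 z q] p(1) qD q_disj yz that by blast
  next
    \<comment> \<open>Here \<open>t\<close> precedes \<open>y\<close>; reversing the path reduces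
      this to the splice with \<open>t\<close> after \<open>y\<close>.\<close>
    case 2
    then obtain p2 p3 where "p1 = p2 @ t # p3" by (meson split_list)
    then have rev: "rev p = rev r @ y # rev p3 @ t # rev p2" using split by simp
    have "is_path D b a (rev r @ y # rev p3 @ t # rev p2)"
      using is_path_rev[OF p(1)] unfolding rev .
    moreover have "set (butlast q) \<inter> set (rev r @ y # rev p3 @ t # rev p2) = {}"
      using q_disj rev by (metis set_rev)
    ultimately have "is_path D b a (rev r @ y # q @ rev p2)"
      "{y, z} \<in> walk_edges (rev r @ y # q @ rev p2)"
      using is_path_splice[of D b a "rev r" y "rev p3" t "rev p2" z q] qD yz by blast+
    then show ?thesis
      using that[of "rev (rev r @ y # q @ rev p2)"] is_path_rev walk_edges_rev by metis
  qed
qed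

text \<open>The hypotheses express 2-connectedness. Along a walk from \<open>a\<close> to
  \<open>y\<close>, rerouting through each edge in turn carries the path from one vertex of the walk
  to the next; a last rerouting at \<open>y\<close> picks up \<open>{y, z}\<close>.\<close>

lemma path_through_edge:
  assumes "simple_graph W D" "connected_graph W D"
    and "\<And>y. y \<in> W \<Longrightarrow> connected_graph (W - {y}) {e \<in> D. y \<notin> e}"
    and ab: "a \<in> W" "b \<in> W" "a \<noteq> b"
    and yz: "{y, z} \<in> D"
  obtains p where "is_path D a b p" "{y, z} \<in> walk_edges p"
proof -
  have W: "u \<in> W" "v \<in> W" if "{u, v} \<in> D" for u v
    using simple_graph.edges_wf[OF assms(1)] that by (auto simp: doubleton_eq_iff)
  have "(a, y) \<in> {(u, v). {u, v} \<in> D}\<^sup>*"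
    using assms(2) ab(1) W(1)[OF yz] unfolding connected_graph_def by blast
  then have "\<exists>p. is_path D a b p \<and> y \<in> set p"
  proof (induction rule: rtrancl_induct)
    case base
    have "(a, b) \<in> {(u, v). {u, v} \<in> D}\<^sup>*"
      using assms(2) ab unfolding connected_graph_def by blast
    then obtain p where "is_path D a b p"
      using path_to_set[of a b D "{b}"] by blast
    then show ?case unfolding is_path_def by (metis hd_in_set)
  next
    case (step u v)
    then obtain p where p: "is_path D a b p" "u \<in> set p" by blast
    have uv: "{u, v} \<in> D" using step(2) by simp
    obtain p' where "is_path D a b p'" "{u, v} \<in> walk_edges p'"
      using path_reroute_edge[OF assms(1) assms(3)[OF W(1)[OF uv]] ab p uv] by blast
    then show ?case using walk_edges_subset by fastforce
  qed
  then obtain p where "is_path D a b p" "y \<in> set p" by blast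
  then show ?thesis
    using path_reroute_edge[OF assms(1) assms(3)[OF W(1)[OF yz]] ab _ _ yz] that by blast
qed

text \<open>The path avoids \<open>v\<close>, since its edges do and its start is not
  \<open>v\<close>. As \<open>a\<close> and \<open>b\<close> differ it has at least two vertices, so
  adding \<open>v\<close> gives the three that a circuit needs.\<close>

lemma circuit_close_path:
  assumes "is_path {e \<in> E. v \<notin> e} a b p" "a \<noteq> b" "{v, a} \<in> E" "{v, b} \<in> E" "v \<noteq> a"
  shows "circuit E (insert {v, a} (insert {v, b} (walk_edges p)))"
proof -
  have p: "p \<noteq> []" "distinct p" "walk_edges p \<subseteq> {e \<in> E. v \<notin> e}" "hd p = a" "last p = b"
    using assms(1) unfolding is_path_def by auto
  have "v \<notin> set p"
    using set_subset_walk_edges[of p] p(3,4) assms(5) by auto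
  moreover have "length p \<ge> 2"
    using p(1,4,5) assms(2) by (cases p; cases "tl p") auto
  ultimately have "distinct (v # p)" "length (v # p) \<ge> 3"
    using p(2) by auto
  moreover have "insert {v, a} (insert {v, b} (walk_edges p)) = cycle_edges (v # p)"
    using p by (simp add: cycle_edges_Cons)
  moreover have "insert {v, a} (insert {v, b} (walk_edges p)) \<subseteq> E"
    using p(3) assms(3,4) by auto
  ultimately show ?thesis
    unfolding circuit_def by metis
qed

section \<open>The preimage of a star\<close>

theorem theorem2:
  fixes V :: "'a set" and E :: "'a set set"
    and V' :: "'b set" and E' :: "'b set set"
    and f :: "'a set \<Rightarrow> 'b set" and w :: 'b
  assumes "simple_graph V E" and "k_connected 3 V E"
    and "simple_graph V' E'"
    and "circuit_injection_onto E V' E' f"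
    and "w \<in> V'"
  shows "(\<exists>v\<in>V. {e \<in> E. f e \<in> star E' w} = star E v) \<or>
         pairwise_nonadjacent {e \<in> E. f e \<in> star E' w}"
proof (rule disjCI)
  let ?A = "{e \<in> E. f e \<in> star E' w}"
  assume "\<not> pairwise_nonadjacent ?A"
  then obtain e e' v where e: "e \<in> ?A" "e' \<in> ?A" "e \<noteq> e'" "v \<in> e" "v \<in> e'"
    unfolding pairwise_nonadjacent_def by blast
  have edge: "\<exists>u. g = {x, u} \<and> u \<noteq> x \<and> x \<in> V \<and> u \<in> V" if "g \<in> E" "x \<in> g" for g x
    using simple_graph.edges_wf[OF assms(1)] that by fastforce
  obtain a where a: "e = {v, a}" "a \<noteq> v" "a \<in> V" and v: "v \<in> V"
    using edge[of e v] e by auto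
  obtain b where b: "e' = {v, b}" "b \<noteq> v" "b \<in> V"
    using edge[of e' v] e by auto
  have "a \<noteq> b" using e(3) a b by auto
  have circ: "circuit E' (f ` C)" if "circuit E C" for C
    using assms(4) that unfolding circuit_injection_onto_def bij_betw_def by auto
  have inj: "inj_on f E"
    using assms(4) unfolding circuit_injection_onto_def bij_betw_def by auto
  \<comment> \<open>The image circuit has exactly two edges at \<open>w\<close>, and injectivity of
    \<open>f\<close> pulls this count back to \<open>C\<close>.\<close>
  have two: "\<exists>h. h \<noteq> g \<and> C \<inter> ?A = {g, h}" if C: "circuit E C" and g: "g \<in> C" "g \<in> ?A" for C g
  proof -
    have CE: "C \<subseteq> E" using C unfolding circuit_def by blast
    obtain h' where h': "h' \<noteq> f g" "f ` C \<inter> star E' w = {f g, h'}"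
      using circuit_inter_star[OF circ[OF C], of "f g" w] g by (auto simp: star_def)
    then have "h' \<in> f ` C \<inter> star E' w" by simp
    then obtain h where h: "h \<in> C" "h' = f h" by blast
    have "f ` (C \<inter> ?A) = f ` C \<inter> star E' w"
      using CE by blast
    then have "f ` (C \<inter> ?A) = f ` {g, h}"
      using h'(2) h(2) by simp
    then have "C \<inter> ?A = {g, h}"
      using inj_on_image_eq_iff[OF inj, of "C \<inter> ?A" "{g, h}"] g h CE by auto
    then show ?thesis using h' h by auto
  qed
  define W where "W = V - {v}"
  define D where "D = {e \<in> E. v \<notin> e}"
  have conn: "connected_graph (V - X) {e \<in> E. e \<inter> X = {}}"
    if "X \<subseteq> V" "finite X" "card X < 3" for X
    using assms(2) that unfolding k_connected_def by blast
  have simple: "simple_graph W D"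
  proof
    show "D \<subseteq> {{x, y} | x y. x \<in> W \<and> y \<in> W \<and> x \<noteq> y}"
      using simple_graph.edges_wf[OF assms(1)] unfolding W_def D_def by fastforce
  qed
  \<comment> \<open>Deleting \<open>{v}\<close> or \<open>{v, y}\<close> from the 3-connected graph
    leaves it connected, so the graph without \<open>v\<close> is 2-connected.\<close>
  have connW: "connected_graph W D"
    using conn[of "{v}"] v unfolding W_def D_def by simp
  have connWy: "connected_graph (W - {y}) {e \<in> D. y \<notin> e}" if "y \<in> W" for y
  proof -
    have "W - {y} = V - {v, y}" "{e \<in> D. y \<notin> e} = {e \<in> E. e \<inter> {v, y} = {}}"
      unfolding W_def D_def by auto
    then show ?thesis
      using conn[of "{v, y}"] v that unfolding W_def by (simp add: card_insert_if)
  qed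
  have sub: "?A \<subseteq> star E v"
  proof
    fix g assume g: "g \<in> ?A"
    show "g \<in> star E v"
    proof (rule ccontr)
      assume "g \<notin> star E v"
      then have gD: "g \<in> D" using g unfolding star_def D_def by auto
      then obtain y z where yz: "g = {y, z}"
        using simple_graph.edges_wf[OF simple] by blast
      obtain p where p: "is_path D a b p" "g \<in> walk_edges p"
        using path_through_edge[OF simple connW connWy, of a b y z] a b \<open>a \<noteq> b\<close> gD
        unfolding yz W_def by auto
      let ?C = "insert {v, a} (insert {v, b} (walk_edges p))"
      have "circuit E ?C"
        using circuit_close_path[of E v a b p] p(1) \<open>a \<noteq> b\<close> a b e unfolding D_def by simp
      then obtain h where "?C \<inter> ?A = {g, h}"
        using two[of ?C g] p(2) g by blast
      \<comment> \<open>Three distinct edges \<open>e\<close>, \<open>e'\<close> and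
        \<open>g\<close> of \<open>?A\<close> on one circuit contradict \<open>two\<close>;
        \<open>g\<close> differs from the others because it avoids \<open>v\<close>.\<close>
      moreover have "e \<in> ?C \<inter> ?A" "e' \<in> ?C \<inter> ?A" using e a b by auto
      moreover have "e \<noteq> g" "e' \<noteq> g" using gD e unfolding D_def by auto
      ultimately show False using e(3) by auto
    qed
  qed
  moreover have "star E v \<subseteq> ?A"
  proof
    fix g assume g: "g \<in> star E v"
    then obtain c where c: "g = {v, c}" "c \<noteq> v" "c \<in> V" "g \<in> E"
      using edge[of g v] unfolding star_def by auto
    show "g \<in> ?A"
    proof (rule ccontr)
      assume gA: "g \<notin> ?A"
      then have "a \<noteq> c" using e(1) a c by auto
      have "(a, c) \<in> {(x, y). {x, y} \<in> D}\<^sup>*"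
        using connW a c unfolding connected_graph_def W_def by blast
      then obtain p where p: "is_path D a c p"
        using path_to_set[of a c D "{c}"] by blast
      let ?C = "insert {v, a} (insert {v, c} (walk_edges p))"
      have "circuit E ?C"
        using circuit_close_path[of E v a c p] p \<open>a \<noteq> c\<close> a c e unfolding D_def by simp
      then obtain h where h: "h \<noteq> e" "?C \<inter> ?A = {e, h}"
        using two[of ?C e] a e by blast
      \<comment> \<open>By \<open>sub\<close> the second edge \<open>h\<close> contains
        \<open>v\<close>, and the only edges of \<open>?C\<close> at \<open>v\<close> are
        \<open>e\<close> and \<open>g\<close>.\<close>
      then have "h \<in> ?C" "h \<in> ?A" "v \<in> h" using sub unfolding star_def by auto
      then have "h = g"
        using h(1) a c p unfolding is_path_def D_def by auto
      then show False using gA \<open>h \<in> ?A\<close> by simp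
    qed
  qed
  ultimately show "\<exists>v\<in>V. ?A = star E v" using v by blast
qed

end
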